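(* Let $\alpha,\beta\in(0,\infty]$ and let $a:=\alpha^{-1}$, $b:=\beta^{-1}$ (with $\infty^{-1}=0$). Let $n\ge 1$ and let $A_{n,\alpha,\beta}=A(S_{n,\alpha,\beta})$ be the number of symbols $\alpha$ on the diagonal of the random $\alpha/\beta$-staircase tableau $S_{n,\alpha,\beta}$. If $(\alpha,\beta)\neq(\infty,\infty)$, then the probability generating function of $A_{n,\alpha,\beta}$ is $$g_A(x):=\mathbb E\, x^{A_{n,\alpha,\beta}}=\sum_{k=0}^n \mathbb P(A_{n,\alpha,\beta}=k)x^k=\frac{P_{n,a,b}(x)}{P_{n,a,b}(1)}=\frac{P_{n,a,b}(x)}{(a+b)^{\overline n}}=\frac{\Gamma(a+b)}{\Gamma(n+a+b)}P_{n,a,b}(x).$$ Equivalently, $$\mathbb P(A_{n,\alpha,\beta}=k)=\frac{v_{a,b}(n,k)}{P_{n,a,b}(1)}=\frac{v_{a,b}(n,k)}{(a+b)^{\overline n}}=\frac{\Gamma(a+b)}{\Gamma(n+a+b)}v_{a,b}(n,k).$$ If $\alpha=\beta=\infty$ and $n\ge 2$, then instead $$g_A(x):=\sum_{k=0}^n \mathbb P(A_{n,\alpha,\beta}=k)x^k=\frac{\tilde P_{n,0,0}(x)}{\tilde P_{n,0,0}(1)}=\frac{\tilde P_{n,0,0}(x)}{(n-1)!},$$ $$\mathbb P(A_{n,\alpha,\beta}=k)=\frac{\tilde v_{0,0}(n,k)}{\tilde P_{n,0,0}(1)}=\frac{\tilde v_{0,0}(n,k)}{(n-1)!}.$$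
   Context: An $\alpha/\beta$-staircase tableau of size $n\ge1$ is a filling of the Young diagram of shape $(n,n-1,\dots,2,1)$, whose boxes are $(i,j)$ (row $i$ from the top, column $j$ from the left) with $i,j\ge1$, $i+j\le n+1$, such that: each box is empty or contains one of the symbols $\alpha,\beta$; no diagonal box (box with $i+j=n+1$) is empty; all boxes in the same row and to the left of a $\beta$ are empty; all boxes in the same column and above an $\alpha$ are empty. Let $\bar{\mathcal S}_n$ be the set of these tableaux. For $S\in\bar{\mathcal S}_n$ let $N_\alpha(S),N_\beta(S)$ be the numbers of symbols $\alpha$ and $\beta$ in $S$, and $A(S)$ the number of symbols $\alpha$ in diagonal boxes. For parameter values $\alpha,\beta\in(0,\infty)$, $S_{n,\alpha,\beta}$ is the random element of $\bar{\mathcal S}_n$ with $\mathbb P(S_{n,\alpha,\beta}=S)=\alpha^{N_\alpha(S)}\beta^{N_\beta(S)}/Z_n(\alpha,\beta)$, where $Z_n(\alpha,\beta)=\sum_{S\in\bar{\mathcal S}_n}\alpha^{N_\alpha(S)}\beta^{N_\beta(S)}$. If exactly one of $\alpha,\beta$ is $\infty$, the distribution is the limit of this one as that parameter tends to $\infty$ with the other fixed; if $\alpha=\beta=\infty$, it is the limit as $\alpha=\beta\to\infty$. The numbers $v_{a,b}(n,k)$, $a,b\in\mathbb R$, $k\in\mathbb Z$, $n\ge0$, are defined by $v_{a,b}(0,0)=1$, $v_{a,b}(0,k)=0$ for $k\ne0$, and $$v_{a,b}(n,k)=(k+a)v_{a,b}(n-1,k)+(n-k+b)v_{a,b}(n-1,k-1),\qquad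 n\ge1,$$ and $P_{n,a,b}(x):=\sum_{k=0}^n v_{a,b}(n,k)x^k$. For $n\ge2$, $\tilde v_{0,0}(n,k):=v_{1,1}(n-2,k-1)$ and $\tilde P_{n,0,0}(x):=\sum_{k=0}^n\tilde v_{0,0}(n,k)x^k=xP_{n-2,1,1}(x)$. The rising factorial is $x^{\overline n}:=x(x+1)\cdots(x+n-1)$. *)

theory Defs
  imports "HOL-Probability.Probability"
begin

section \<open>Staircase tableaux\<close>

datatype symbol = Alpha | Beta

type_synonym filling = "nat \<times> nat \<Rightarrow> symbol option"

definition boxes :: "nat \<Rightarrow> (nat \<times> nat) set" where
  "boxes n = {(i, j). 1 \<le> i \<and> 1 \<le> j \<and> i + j \<le> n + 1}"

definition diagonal :: "nat \<Rightarrow> (nat \<times> nat) set" where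
  "diagonal n = {(i, j). 1 \<le> i \<and> 1 \<le> j \<and> i + j = n + 1}"

text \<open>An empty box has value \<^term>\<open>None\<close>. A filling is also \<^term>\<open>None\<close> outside the diagram, so that
  each tableau is represented by exactly one function.\<close>

definition staircase_tableaux :: "nat \<Rightarrow> filling set" where
  "staircase_tableaux n = {S.
     (\<forall>c. c \<notin> boxes n \<longrightarrow> S c = None) \<and>
     (\<forall>c\<in>diagonal n. S c \<noteq> None) \<and>
     (\<forall>i j j'. (i, j) \<in> boxes n \<and> S (i, j) = Some Beta \<and> j' < j \<longrightarrow> S (i, j') = None) \<and>
     (\<forall>i i' j. (i, j) \<in> boxes n \<and> S (i, j) = Some Alpha \<and> i' < i \<longrightarrow> S (i', j) = None)}"

definition num_symbol :: "symbol \<Rightarrow> filling \<Rightarrow> nat" where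
  "num_symbol s S = card {c. S c = Some s}"

definition diag_alphas :: "nat \<Rightarrow> filling \<Rightarrow> nat" where
  "diag_alphas n S = card {c \<in> diagonal n. S c = Some Alpha}"

section \<open>The random tableau\<close>

definition weight :: "real \<Rightarrow> real \<Rightarrow> filling \<Rightarrow> real" where
  "weight \<alpha> \<beta> S = \<alpha> ^ num_symbol Alpha S * \<beta> ^ num_symbol Beta S"

definition Z :: "nat \<Rightarrow> real \<Rightarrow> real \<Rightarrow> real" where
  "Z n \<alpha> \<beta> = (\<Sum>S\<in>staircase_tableaux n. weight \<alpha> \<beta> S)"

definition tableau_prob_finite :: "nat \<Rightarrow> real \<Rightarrow> real \<Rightarrow> filling \<Rightarrow> real" where
  "tableau_prob_finite n \<alpha> \<beta> S =
     (if S \<in> staircase_tableaux n then weight \<alpha> \<beta> S / Z n \<alpha> \<beta> else 0)"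

text \<open>Infinite parameters are handled by taking limits. As the set of tableaux is finite, the limit
  of the distributions is the pointwise limit of the probabilities. It exists by
  \<open>tableau_prob_limits\<close> below, and \<open>pmf_tableau_pmf\<close> shows that it is a probability distribution.\<close>

definition tableau_prob :: "nat \<Rightarrow> ereal \<Rightarrow> ereal \<Rightarrow> filling \<Rightarrow> real" where
  "tableau_prob n \<alpha> \<beta> S =
     (if \<alpha> = \<infinity> \<and> \<beta> = \<infinity> then Lim at_top (\<lambda>t. tableau_prob_finite n t t S)
      else if \<alpha> = \<infinity> then Lim at_top (\<lambda>t. tableau_prob_finite n t (real_of_ereal \<beta>) S)
      else if \<beta> = \<infinity> then Lim at_top (\<lambda>t. tableau_prob_finite n (real_of_ereal \<alpha>) t S)
      else tableau_prob_finite n (real_of_ereal \<alpha>) (real_of_ereal \<beta>) S)"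

definition tableau_pmf :: "nat \<Rightarrow> ereal \<Rightarrow> ereal \<Rightarrow> filling pmf" where
  "tableau_pmf n \<alpha> \<beta> = embed_pmf (tableau_prob n \<alpha> \<beta>)"

section \<open>The numbers \<open>v\<close> and their polynomials\<close>

primrec v :: "real \<Rightarrow> real \<Rightarrow> nat \<Rightarrow> int \<Rightarrow> real" where
  "v a b 0 k = (if k = 0 then 1 else 0)"
| "v a b (Suc n) k =
     (of_int k + a) * v a b n k + (real (Suc n) - of_int k + b) * v a b n (k - 1)"

definition P :: "nat \<Rightarrow> real \<Rightarrow> real \<Rightarrow> real \<Rightarrow> real" where
  "P n a b x = (\<Sum>k = 0..n. v a b n (int k) * x ^ k)"

text \<open>The next two are meaningful for \<open>n \<ge> 2\<close> only.\<close>

definition v_tilde :: "nat \<Rightarrow> int \<Rightarrow> real" where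
  "v_tilde n k = v 1 1 (n - 2) (k - 1)"

definition P_tilde :: "nat \<Rightarrow> real \<Rightarrow> real" where
  "P_tilde n x = (\<Sum>k = 0..n. v_tilde n (int k) * x ^ k)"

lemma v_eq_0: "k < 0 \<or> k > int n \<Longrightarrow> n > 0 \<or> k \<noteq> 0 \<Longrightarrow> v a b n k = 0"
  by (induction n arbitrary: k) auto

lemma P_tilde_eq:
  assumes "n \<ge> 2"
  shows "P_tilde n x = x * P (n - 2) 1 1 x"
proof -
  obtain m where n: "n = Suc (Suc m)"
    using assms that[of "n - 2"] by linarith
  have "P_tilde n x = (\<Sum>k = 0..Suc (Suc m). v 1 1 m (int k - 1) * x ^ k)"
    by (simp add: P_tilde_def v_tilde_def n)
  also have "\<dots> = (\<Sum>k = 0..Suc m. v 1 1 m (int k) * x ^ Suc k)"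
    by (subst sum.atLeast0_atMost_Suc_shift) (simp add: v_eq_0)
  also have "\<dots> = (\<Sum>k = 0..m. v 1 1 m (int k) * x ^ Suc k)"
    by (simp add: v_eq_0)
  also have "\<dots> = x * P (n - 2) 1 1 x"
    by (simp add: P_def n sum_distrib_left mult_ac)
  finally show ?thesis .
qed

section \<open>The distribution is well defined\<close>

lemma finite_staircase_tableaux: "finite (staircase_tableaux n)"
proof -
  have "boxes n \<subseteq> {..n+1} \<times> {..n+1}"
    by (auto simp: boxes_def)
  then have fb: "finite (boxes n)"
    by (rule finite_subset) auto
  let ?B = "{None, Some Alpha, Some Beta}"
  have B: "x \<in> ?B" for x
  proof (cases x)
    case (Some s)
    then show ?thesis by (cases s) auto
  qed auto
  have "staircase_tableaux n \<subseteq> {S. \<forall>c. (c \<in> boxes n \<longrightarrow> S c \<in> ?B) \<and> (c \<notin> boxes n \<longrightarrow> S c = None)}"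
    using B by (simp add: staircase_tableaux_def Collect_mono)
  moreover have "finite {S. \<forall>c. (c \<in> boxes n \<longrightarrow> S c \<in> ?B) \<and> (c \<notin> boxes n \<longrightarrow> S c = (None :: symbol option))}"
    by (rule finite_set_of_finite_funs) (use fb in auto)
  ultimately show ?thesis by (rule finite_subset)
qed

lemma staircase_tableaux_nonempty: "staircase_tableaux n \<noteq> {}"
proof -
  have "(\<lambda>c. if c \<in> diagonal n then Some Alpha else None) \<in> staircase_tableaux n"
    by (auto simp: staircase_tableaux_def diagonal_def boxes_def)
  then show ?thesis by blast
qed

lemma weight_pos: "\<alpha> > 0 \<Longrightarrow> \<beta> > 0 \<Longrightarrow> weight \<alpha> \<beta> S > 0"
  by (simp add: weight_def)

lemma Z_pos: "\<alpha> > 0 \<Longrightarrow> \<beta> > 0 \<Longrightarrow> Z n \<alpha> \<beta> > 0"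
  unfolding Z_def
  by (intro sum_pos finite_staircase_tableaux staircase_tableaux_nonempty weight_pos)

lemma monomial_ratio_converges:
  fixes c :: "'s \<Rightarrow> real" and e :: "'s \<Rightarrow> nat"
  assumes F: "finite F" "S \<in> F" and c: "\<And>T. T \<in> F \<Longrightarrow> c T > 0"
  shows "\<exists>L. ((\<lambda>t. (c S * t ^ e S) / (\<Sum>T\<in>F. c T * t ^ e T)) \<longlongrightarrow> L) at_top"
proof -
  define M where "M = Max (e ` F)"
  have le: "e T \<le> M" if "T \<in> F" for T
    using F that by (simp add: M_def)
  have "M \<in> e ` F"
    unfolding M_def using F by (intro Max_in) auto
  then obtain T0 where T0: "T0 \<in> F" "e T0 = M" by auto
  define l where "l T = (if e T = M then 1 else 0 :: real)" for T
  have lim: "((\<lambda>t::real. t ^ e T / t ^ M) \<longlongrightarrow> l T) at_top" if T: "T \<in> F" for T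
  proof (cases "e T = M")
    case True
    have "\<forall>\<^sub>F t::real in at_top. t ^ e T / t ^ M = 1"
      using eventually_gt_at_top[of 0] by eventually_elim (simp add: True)
    then show ?thesis
      by (simp add: l_def True tendsto_eventually)
  next
    case False
    then have d: "M - e T > 0" using le[OF T] by simp
    have "\<forall>\<^sub>F t::real in at_top. inverse (t ^ (M - e T)) = t ^ e T / t ^ M"
      using eventually_gt_at_top[of 0]
      by eventually_elim (simp add: power_diff le[OF T] field_simps)
    moreover have "((\<lambda>t::real. inverse (t ^ (M - e T))) \<longlongrightarrow> 0) at_top"
      by (intro tendsto_inverse_0_at_top filterlim_pow_at_top d filterlim_ident)
    ultimately show ?thesis
      using False by (simp add: l_def tendsto_cong)
  qed
  have "(\<Sum>T\<in>F. c T * l T) > 0"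
    by (rule sum_pos2[OF F(1) T0(1)]) (use c T0 in \<open>auto simp: l_def less_imp_le\<close>)
  then have "((\<lambda>t. (c S * (t ^ e S / t ^ M)) / (\<Sum>T\<in>F. c T * (t ^ e T / t ^ M)))
      \<longlongrightarrow> (c S * l S) / (\<Sum>T\<in>F. c T * l T)) at_top"
    using F by (intro tendsto_divide tendsto_mult tendsto_const tendsto_sum lim) auto
  moreover have "\<forall>\<^sub>F t in at_top. (c S * (t ^ e S / t ^ M)) / (\<Sum>T\<in>F. c T * (t ^ e T / t ^ M)) =
      (c S * t ^ e S) / (\<Sum>T\<in>F. c T * t ^ e T)"
    using eventually_gt_at_top[of "0::real"]
  proof eventually_elim
    case (elim t)
    have "(\<Sum>T\<in>F. c T * (t ^ e T / t ^ M)) = (\<Sum>T\<in>F. c T * t ^ e T) / t ^ M"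
      by (simp add: sum_divide_distrib)
    then show ?case using elim by simp
  qed
  ultimately show ?thesis
    by (blast intro: Lim_transform_eventually)
qed

lemma tendsto_Lim_real: "(f \<longlongrightarrow> L) at_top \<Longrightarrow> (f \<longlongrightarrow> Lim at_top f) (at_top :: real filter)"
  using tendsto_Lim[OF trivial_limit_at_top_linorder, of f L] by simp

lemma tableau_prob_limits:
  fixes b :: real
  shows "((\<lambda>t. tableau_prob_finite n t t S) \<longlongrightarrow> tableau_prob n \<infinity> \<infinity> S) at_top"
    and "b > 0 \<Longrightarrow> ((\<lambda>t. tableau_prob_finite n t b S) \<longlongrightarrow> tableau_prob n \<infinity> (ereal b) S) at_top"
    and "b > 0 \<Longrightarrow> ((\<lambda>t. tableau_prob_finite n b t S) \<longlongrightarrow> tableau_prob n (ereal b) \<infinity> S) at_top"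
proof -
  note conv = monomial_ratio_converges[OF finite_staircase_tableaux]
  have "\<exists>L. ((\<lambda>t. tableau_prob_finite n t t S) \<longlongrightarrow> L) at_top"
  proof (cases "S \<in> staircase_tableaux n")
    case True
    from conv[OF True, of "\<lambda>_. 1" "\<lambda>T. num_symbol Alpha T + num_symbol Beta T"] show ?thesis
      by (simp add: tableau_prob_finite_def True weight_def Z_def power_add)
  qed (auto simp: tableau_prob_finite_def)
  then show "((\<lambda>t. tableau_prob_finite n t t S) \<longlongrightarrow> tableau_prob n \<infinity> \<infinity> S) at_top"
    by (auto simp: tableau_prob_def intro: tendsto_Lim_real)
next
  note conv = monomial_ratio_converges[OF finite_staircase_tableaux]
  assume b: "b > 0"
  have "\<exists>L. ((\<lambda>t. tableau_prob_finite n t b S) \<longlongrightarrow> L) at_top"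
  proof (cases "S \<in> staircase_tableaux n")
    case True
    from conv[OF True, of "\<lambda>T. b ^ num_symbol Beta T" "num_symbol Alpha"] show ?thesis
      by (simp add: tableau_prob_finite_def True weight_def Z_def b mult.commute)
  qed (auto simp: tableau_prob_finite_def)
  then show "((\<lambda>t. tableau_prob_finite n t b S) \<longlongrightarrow> tableau_prob n \<infinity> (ereal b) S) at_top"
    by (auto simp: tableau_prob_def intro: tendsto_Lim_real)
  have "\<exists>L. ((\<lambda>t. tableau_prob_finite n b t S) \<longlongrightarrow> L) at_top"
  proof (cases "S \<in> staircase_tableaux n")
    case True
    from conv[OF True, of "\<lambda>T. b ^ num_symbol Alpha T" "num_symbol Beta"] show ?thesis
      by (simp add: tableau_prob_finite_def True weight_def Z_def b)
  qed (auto simp: tableau_prob_finite_def)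
  then show "((\<lambda>t. tableau_prob_finite n b t S) \<longlongrightarrow> tableau_prob n (ereal b) \<infinity> S) at_top"
    by (auto simp: tableau_prob_def intro: tendsto_Lim_real)
qed

lemma tableau_prob_finite_nonneg: "\<alpha> > 0 \<Longrightarrow> \<beta> > 0 \<Longrightarrow> tableau_prob_finite n \<alpha> \<beta> S \<ge> 0"
  using weight_pos[of \<alpha> \<beta> S] Z_pos[of \<alpha> \<beta> n] by (simp add: tableau_prob_finite_def)

lemma sum_tableau_prob_finite:
  "\<alpha> > 0 \<Longrightarrow> \<beta> > 0 \<Longrightarrow> (\<Sum>S\<in>staircase_tableaux n. tableau_prob_finite n \<alpha> \<beta> S) = 1"
  using Z_pos[of \<alpha> \<beta> n]
  by (simp add: tableau_prob_finite_def flip: sum_divide_distrib Z_def)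

lemma limit_is_distribution:
  fixes f :: "real \<Rightarrow> filling \<Rightarrow> real"
  assumes lim: "\<And>S. ((\<lambda>t. f t S) \<longlongrightarrow> p S) at_top"
    and nonneg: "\<And>t S. t > 0 \<Longrightarrow> f t S \<ge> 0"
    and sum: "\<And>t. t > 0 \<Longrightarrow> (\<Sum>S\<in>F. f t S) = 1"
    and out: "\<And>t S. S \<notin> F \<Longrightarrow> f t S = 0"
  shows "(\<forall>S. p S \<ge> 0) \<and> (\<Sum>S\<in>F. p S) = 1 \<and> (\<forall>S. S \<notin> F \<longrightarrow> p S = 0)"
proof (intro conjI allI impI)
  show "p S \<ge> 0" for S
    by (rule tendsto_lowerbound[OF lim eventually_mono[OF eventually_gt_at_top[of 0]]])
      (use nonneg in auto)
  have "((\<lambda>t. \<Sum>S\<in>F. f t S) \<longlongrightarrow> (\<Sum>S\<in>F. p S)) at_top"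
    by (intro tendsto_sum lim)
  moreover have "((\<lambda>t. \<Sum>S\<in>F. f t S) \<longlongrightarrow> 1) at_top"
    by (rule tendsto_eventually, rule eventually_mono[OF eventually_gt_at_top[of 0]]) (rule sum)
  ultimately show "(\<Sum>S\<in>F. p S) = 1"
    by (rule tendsto_unique[OF trivial_limit_at_top_linorder])
  show "p S = 0" if "S \<notin> F" for S
    using lim[of S] out[OF that] by (simp add: tendsto_const_iff)
qed

lemma tableau_prob_is_distribution:
  assumes "\<alpha> > 0" "\<beta> > 0"
  shows "(\<forall>S. tableau_prob n \<alpha> \<beta> S \<ge> 0) \<and>
    (\<Sum>S\<in>staircase_tableaux n. tableau_prob n \<alpha> \<beta> S) = 1 \<and>
    (\<forall>S. S \<notin> staircase_tableaux n \<longrightarrow> tableau_prob n \<alpha> \<beta> S = 0)"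
proof (cases \<alpha>)
  case (real r)
  note r = this
  with assms have r0: "r > 0" by simp
  show ?thesis
  proof (cases \<beta>)
    case (real s)
    with assms r0 show ?thesis
      by (simp add: r tableau_prob_def tableau_prob_finite_nonneg sum_tableau_prob_finite)
        (simp add: tableau_prob_finite_def)
  next
    case PInf
    show ?thesis unfolding r PInf
      by (rule limit_is_distribution[OF tableau_prob_limits(3)[OF r0]])
        (use r0 in \<open>auto simp: tableau_prob_finite_nonneg sum_tableau_prob_finite\<close>,
          simp add: tableau_prob_finite_def)
  qed (use assms in auto)
next
  case PInf
  note r = this
  show ?thesis
  proof (cases \<beta>)
    case (real s)
    with assms have s0: "s > 0" by simp
    show ?thesis unfolding r real
      by (rule limit_is_distribution[OF tableau_prob_limits(2)[OF s0]])
        (use s0 in \<open>auto simp: tableau_prob_finite_nonneg sum_tableau_prob_finite\<close>,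
          simp add: tableau_prob_finite_def)
  next
    case PInf
    show ?thesis unfolding r PInf
      by (rule limit_is_distribution[OF tableau_prob_limits(1)])
        (auto simp: tableau_prob_finite_nonneg sum_tableau_prob_finite,
          simp add: tableau_prob_finite_def)
  qed (use assms in auto)
qed (use assms in auto)

lemma pmf_tableau_pmf:
  assumes "\<alpha> > 0" "\<beta> > 0"
  shows "pmf (tableau_pmf n \<alpha> \<beta>) S = tableau_prob n \<alpha> \<beta> S"
  unfolding tableau_pmf_def
proof (rule pmf_embed_pmf)
  note d = tableau_prob_is_distribution[OF assms, of n]
  show "0 \<le> tableau_prob n \<alpha> \<beta> T" for T using d by blast
  have "(\<integral>\<^sup>+ T. ennreal (tableau_prob n \<alpha> \<beta> T) \<partial>count_space UNIV) =
      (\<Sum>T\<in>staircase_tableaux n. ennreal (tableau_prob n \<alpha> \<beta> T))"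
    by (rule nn_integral_count_space') (use d in \<open>auto simp: finite_staircase_tableaux\<close>)
  also have "\<dots> = ennreal (\<Sum>T\<in>staircase_tableaux n. tableau_prob n \<alpha> \<beta> T)"
    using d by (intro sum_ennreal) auto
  finally show "(\<integral>\<^sup>+ T. ennreal (tableau_prob n \<alpha> \<beta> T) \<partial>count_space UNIV) = 1"
    using d by simp
qed

end

theory Submission
  imports Defs
begin

text \<open>
  Call a row of a tableau \<^emph>\<open>free\<close> if it contains no \<open>\<beta>\<close>. A tableau of size \<open>n + 1\<close> is a tableau of
  size \<open>n\<close> with a new first column attached, and the only thing that limits the choice of this
  column is which rows are free: a box to the left of a \<open>\<beta>\<close> must stay empty. Hence the
  generating function \<open>F\<^sub>n(z)\<close>, the sum over all tableaux of size \<open>n\<close> of their weight times \<open>x\<close> to the number of diagonal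
  \<open>\<alpha>\<close> times \<open>z\<close> to the number of free rows, satisfies a recursion in \<open>n\<close>. To find it, read the new
  column upwards. Its bottom box is on the diagonal and holds \<open>\<alpha>\<close> or \<open>\<beta>\<close>. An \<open>\<alpha>\<close> ends the column.
  After a \<open>\<beta>\<close>, every free row is left alone, or receives a \<open>\<beta>\<close> and stops being free, or receives an
  \<open>\<alpha>\<close>, which ends the column. Summing over these choices (\<open>sum_columns\<close>) gives
  \<open>F\<^sub>n\<^sub>+\<^sub>1(z) = \<alpha> z (x - 1) F\<^sub>n(z) + (\<beta> + \<alpha> z) F\<^sub>n(z + \<beta>)\<close>,
  which is \<open>sum_refined_weight_Suc\<close>.

  With \<open>a = 1/\<alpha>\<close>, the substitution \<open>z = \<beta> y\<close> and division by \<open>(\<alpha> \<beta>)\<^sup>n\<close> turn this into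
  \<open>Q\<^sub>n\<^sub>+\<^sub>1(y) = y (x - 1) Q\<^sub>n(y) + (a + y) Q\<^sub>n(y + 1)\<close>.
  The polynomials \<open>P\<close> satisfy the same recursion in their second parameter (\<open>P_Suc\<close>), so
  \<open>F\<^sub>n(z) = (\<alpha> \<beta>)\<^sup>n P n (1/\<alpha>) (z/\<beta>) x\<close> (\<open>sum_refined_weight\<close>). At \<open>z = 1\<close> this is, up to
  normalization, the generating function of \<open>A\<close> for finite parameters, and at \<open>x = 1\<close> the recursion for \<open>P\<close> collapses to that of
  the rising factorial.

  Infinite parameters are limits, and \<open>P n a b x\<close> is continuous in \<open>a\<close> and \<open>b\<close>. If only one
  parameter is infinite, then \<open>a + b > 0\<close> and the normalization stays positive. If both are, then
  \<open>P n a a x\<close> and \<open>P n a a 1\<close> vanish in the limit \<open>a \<rightarrow> 0\<close>; the recursion shows that both have the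
  factor \<open>2 a\<close>, and what remains of \<open>P n a a x\<close> after cancelling it tends to \<open>P_tilde n x\<close>.
\<close>

section \<open>Shifting the second parameter of the polynomials \<open>P\<close>\<close>

text \<open>The defining recursion of \<open>v\<close> keeps the parameters fixed. This one trades a step in \<open>n\<close> for a
  shift of \<open>b\<close>, which is what a step in the size of the tableau does to the variable counting free
  rows. Both sides obey the defining recursion at level \<open>n + 1\<close>: the shift of \<open>b\<close> by 1 compensates
  the shift of \<open>n\<close> by 1 in the coefficient \<open>n - k + b\<close>.\<close>

lemma v_shift:
  "v a b (Suc n) k = b * (v a b n (k - 1) - v a b n k) + (a + b) * v a (b + 1) n k"
proof (induction n arbitrary: k)
  case 0
  then show ?case by (auto simp: algebra_simps)
next
  case (Suc n)
  have "v a b (Suc (Suc n)) k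
      = (of_int k + a) * v a b (Suc n) k + (real (Suc (Suc n)) - of_int k + b) * v a b (Suc n) (k - 1)"
    by simp
  also have "\<dots> = (of_int k + a) * (b * (v a b n (k - 1) - v a b n k) + (a + b) * v a (b + 1) n k)
      + (real (Suc (Suc n)) - of_int k + b) *
        (b * (v a b n (k - 1 - 1) - v a b n (k - 1)) + (a + b) * v a (b + 1) n (k - 1))"
    by (simp only: Suc.IH)
  also have "\<dots> = b * (v a b (Suc n) (k - 1) - v a b (Suc n) k) + (a + b) * v a (b + 1) (Suc n) k"
    by (simp add: algebra_simps)
  finally show ?case .
qed

lemma P_Suc:
  "P (Suc n) a b x = b * (x - 1) * P n a b x + (a + b) * P n a (b + 1) x"
proof -
  have top: "(\<Sum>k = 0..Suc n. v a c n (int k) * x ^ k) = P n a c x" for c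
    by (simp add: P_def v_eq_0)
  have shifted: "(\<Sum>k = 0..Suc n. v a b n (int k - 1) * x ^ k) = x * P n a b x"
    by (subst sum.atLeast0_atMost_Suc_shift) (simp add: P_def v_eq_0 sum_distrib_left mult_ac)
  have "P (Suc n) a b x = (\<Sum>k = 0..Suc n. b * (v a b n (int k - 1) * x ^ k)
      - b * (v a b n (int k) * x ^ k) + (a + b) * (v a (b + 1) n (int k) * x ^ k))"
    unfolding P_def v_shift by (rule sum.cong) (simp_all only: algebra_simps)
  also have "\<dots> = b * (x * P n a b x) - b * P n a b x + (a + b) * P n a (b + 1) x"
    by (simp only: sum.distrib sum_subtractf sum_distrib_left[symmetric] top shifted)
  finally show ?thesis
    by (simp only: algebra_simps)
qed

lemma P_at_1: "P n a b 1 = pochhammer (a + b) n"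
proof (induction n arbitrary: b)
  case 0
  then show ?case by (simp add: P_def)
next
  case (Suc n)
  then show ?case by (simp add: P_Suc pochhammer_rec add.assoc)
qed

section \<open>Columns that avoid the rows containing a \<open>\<beta>\<close>\<close>

text \<open>A column is a function of the row index, and \<open>R\<close> is the set of rows in which it may have a
  symbol. The second condition is the rule for a column of a tableau: nothing above an \<open>\<alpha>\<close>.\<close>

definition columns :: "nat set \<Rightarrow> (nat \<Rightarrow> symbol option) set" where
  "columns R = {c. (\<forall>i. i \<notin> R \<longrightarrow> c i = None) \<and>
     (\<forall>i i'. c i = Some Alpha \<and> i' < i \<longrightarrow> c i' = None)}"

text \<open>The factor \<open>z\<close> marks the rows of \<open>R\<close> that remain free, which are those without a new \<open>\<beta>\<close>.\<close>

fun cell_weight :: "real \<Rightarrow> real \<Rightarrow> real \<Rightarrow> symbol option \<Rightarrow> real" where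
  "cell_weight \<alpha> \<beta> z None = z"
| "cell_weight \<alpha> \<beta> z (Some Alpha) = \<alpha> * z"
| "cell_weight \<alpha> \<beta> z (Some Beta) = \<beta>"

lemma columns_empty: "columns {} = {\<lambda>_. None}"
  by (auto simp: columns_def)

lemma columns_bottom_None:
  assumes "\<And>i. i \<in> R \<Longrightarrow> i < m"
  shows "{c \<in> columns (insert m R). c m = None} = columns R"
proof -
  have "m \<notin> R" using assms by blast
  then show ?thesis by (auto simp: columns_def) (metis)
qed

text \<open>An \<open>\<alpha>\<close> in the lowest box empties all others, while a \<open>\<beta>\<close> there does not restrict the boxes
  above it.\<close>

lemma columns_bottom_filled:
  assumes R: "\<And>i. i \<in> R \<Longrightarrow> i < m"
  shows "{c \<in> columns (insert m R). c m \<noteq> None} =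
    insert ((\<lambda>_. None)(m := Some Alpha)) ((\<lambda>c. c(m := Some Beta)) ` columns R)"
proof (intro equalityI subsetI)
  fix c assume c: "c \<in> {c \<in> columns (insert m R). c m \<noteq> None}"
  then obtain s where s: "c m = Some s" by auto
  show "c \<in> insert ((\<lambda>_. None)(m := Some Alpha)) ((\<lambda>c. c(m := Some Beta)) ` columns R)"
  proof (cases s)
    case Alpha
    have "c i = None" if "i \<noteq> m" for i
      using c s that Alpha R[of i] by (auto simp: columns_def)
    then have "c = (\<lambda>_. None)(m := Some Alpha)"
      using s Alpha by (auto simp: fun_eq_iff)
    then show ?thesis by blast
  next
    case Beta
    then have "c = (c(m := None))(m := Some Beta)" "c(m := None) \<in> columns R"
      using c s by (auto simp: columns_def fun_eq_iff)
    then show ?thesis by blast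
  qed
next
  fix c assume "c \<in> insert ((\<lambda>_. None)(m := Some Alpha)) ((\<lambda>c. c(m := Some Beta)) ` columns R)"
  then consider "c = (\<lambda>_. None)(m := Some Alpha)"
    | d where "d \<in> columns R" "c = d(m := Some Beta)" by blast
  then show "c \<in> {c \<in> columns (insert m R). c m \<noteq> None}"
  proof cases
    case (2 d)
    have "i < m" if "d i = Some Alpha" for i
      using that 2(1) R[of i] by (cases "i \<in> R") (auto simp: columns_def)
    with 2 show ?thesis by (fastforce simp: columns_def)
  qed (auto simp: columns_def)
qed

lemma finite_columns: "finite R \<Longrightarrow> finite (columns R)"
proof (induction R rule: finite_linorder_max_induct)
  case empty
  then show ?case by (simp add: columns_empty)
next
  case (insert m R)
  have "columns (insert m R) =
      {c \<in> columns (insert m R). c m = None} \<union> {c \<in> columns (insert m R). c m \<noteq> None}"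
    by blast
  also have "finite \<dots>"
    using insert.hyps insert.IH by (simp add: columns_bottom_None columns_bottom_filled del: not_None_eq)
  finally show ?case .
qed

lemma sum_columns_bottom_filled:
  fixes f :: "(nat \<Rightarrow> symbol option) \<Rightarrow> real"
  assumes fin: "finite R" and R: "\<And>i. i \<in> R \<Longrightarrow> i < m"
  shows "(\<Sum>c \<in> {c \<in> columns (insert m R). c m \<noteq> None}. f c) =
    f ((\<lambda>_. None)(m := Some Alpha)) + (\<Sum>c\<in>columns R. f (c(m := Some Beta)))"
proof -
  have "m \<notin> R" using R by blast
  then have None_m: "c m = None" if "c \<in> columns R" for c
    using that by (simp add: columns_def)
  have inj: "inj_on (\<lambda>c. c(m := Some Beta)) (columns R)"
  proof (rule inj_onI)
    fix c d assume "c \<in> columns R" "d \<in> columns R" "c(m := Some Beta) = d(m := Some Beta)"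
    then show "c = d"
      using None_m by (metis fun_upd_triv fun_upd_upd)
  qed
  have "(\<lambda>_. None)(m := Some Alpha) \<notin> (\<lambda>c. c(m := Some Beta)) ` columns R"
    by (auto dest: fun_cong[where x = m])
  then show ?thesis
    using fin by (simp add: columns_bottom_filled[OF R] del: not_None_eq add: finite_columns sum.reindex[OF inj])
qed

text \<open>Let \<open>G\<^sub>r\<close> be the sum over the columns for \<open>r\<close> free rows. The lowest of these rows is empty or
  holds a \<open>\<beta>\<close> or an \<open>\<alpha>\<close>, so \<open>G\<^sub>r\<^sub>+\<^sub>1 = (z + \<beta>) G\<^sub>r + \<alpha> z z\<^sup>r\<close> with \<open>G\<^sub>0 = 1\<close>. Solving this gives a closed
  form with denominator \<open>\<beta>\<close>, which is multiplied out here because the column of a tableau has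
  a \<open>\<beta>\<close> in its diagonal box below exactly such a column.\<close>

lemma sum_columns:
  assumes "finite R"
  shows "\<beta> * (\<Sum>c\<in>columns R. \<Prod>i\<in>R. cell_weight \<alpha> \<beta> z (c i)) =
    (\<beta> + \<alpha> * z) * (z + \<beta>) ^ card R - \<alpha> * z * z ^ card R"
  using assms
proof (induction R rule: finite_linorder_max_induct)
  case empty
  then show ?case by (simp add: columns_empty algebra_simps)
next
  case (insert m R)
  let ?w = "\<lambda>R c. \<Prod>i\<in>R. cell_weight \<alpha> \<beta> z (c i)"
  have m: "m \<notin> R" using insert.hyps by blast
  have split: "columns (insert m R) =
      {c \<in> columns (insert m R). c m = None} \<union> {c \<in> columns (insert m R). c m \<noteq> None}"
    by blast
  have fin: "finite (columns (insert m R))" using insert.hyps by (intro finite_columns) simp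
  have w_ins: "?w (insert m R) c = cell_weight \<alpha> \<beta> z (c m) * ?w R c" for c
    using insert.hyps m by simp
  have w_upd: "?w R (c(m := s)) = ?w R c" for c s
    using m by (intro prod.cong) auto
  have cN: "c m = None" if "c \<in> columns R" for c
    using that m by (simp add: columns_def)
  have "(\<Sum>c\<in>columns (insert m R). ?w (insert m R) c) =
     (\<Sum>c\<in>{c \<in> columns (insert m R). c m = None}. ?w (insert m R) c) +
     (\<Sum>c\<in>{c \<in> columns (insert m R). c m \<noteq> None}. ?w (insert m R) c)"
    by (subst split, rule sum.union_disjoint) (use fin in auto)
  also have "(\<Sum>c\<in>{c \<in> columns (insert m R). c m = None}. ?w (insert m R) c)
      = z * (\<Sum>c\<in>columns R. ?w R c)"
    using insert.hyps(2) by (simp add: columns_bottom_None w_ins cN sum_distrib_left)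
  also have "(\<Sum>c\<in>{c \<in> columns (insert m R). c m \<noteq> None}. ?w (insert m R) c)
      = \<alpha> * z * z ^ card R + \<beta> * (\<Sum>c\<in>columns R. ?w R c)"
    using insert.hyps
    by (subst sum_columns_bottom_filled) (simp_all add: w_ins w_upd sum_distrib_left del: prod.insert fun_upd_apply, simp)
  finally have "\<beta> * (\<Sum>c\<in>columns (insert m R). ?w (insert m R) c) =
      (z + \<beta>) * (\<beta> * (\<Sum>c\<in>columns R. ?w R c)) + \<beta> * \<alpha> * z * z ^ card R"
    by (simp add: algebra_simps)
  then show ?case
    using insert.hyps m by (simp only: insert.IH) (simp add: algebra_simps)
qed


lemma prod_cell_weight:
  assumes R: "finite R" and c: "c \<in> columns R"
  shows "(\<Prod>i\<in>R. cell_weight \<alpha> \<beta> z (c i)) =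
    \<alpha> ^ card {i. c i = Some Alpha} * \<beta> ^ card {i. c i = Some Beta}
      * z ^ card {i \<in> R. c i \<noteq> Some Beta}"
proof -
  have pow: "y ^ card {i \<in> R. Q i} = (\<Prod>i\<in>R. if Q i then y else 1)" for y :: real and Q
    using R by (simp add: prod.If_cases Int_def)
  have sub: "{i. c i = Some s} = {i \<in> R. c i = Some s}" for s
    using c by (auto simp: columns_def)
  have cell: "cell_weight \<alpha> \<beta> z s = (if s = Some Alpha then \<alpha> else 1) * (if s = Some Beta then \<beta> else 1)
     * (if s \<noteq> Some Beta then z else 1)" for s
    by (cases "(\<alpha>, \<beta>, z, s)" rule: cell_weight.cases) auto
  show ?thesis
    by (simp only: sub pow cell prod.distrib)
qed

section \<open>Attaching a first column to a tableau\<close>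

definition beta_free_rows :: "nat \<Rightarrow> filling \<Rightarrow> nat set" where
  "beta_free_rows n S = {i \<in> {1..n}. \<forall>j. S (i, j) \<noteq> Some Beta}"

text \<open>The new row \<open>n + 1\<close> consists of the diagonal box of the new column only. No \<open>\<beta>\<close> lies
  to its right, and being diagonal it must be filled.\<close>

definition first_columns :: "nat \<Rightarrow> filling \<Rightarrow> (nat \<Rightarrow> symbol option) set" where
  "first_columns n S = {c \<in> columns (insert (Suc n) (beta_free_rows n S)). c (Suc n) \<noteq> None}"

text \<open>Columns are numbered from 1, so the new column has index 1 and the old ones move up by one.
  Index 0 is outside the diagram and must stay empty.\<close>

definition attach_column :: "(nat \<Rightarrow> symbol option) \<Rightarrow> filling \<Rightarrow> filling" where
  "attach_column c S = (\<lambda>(i, j). case j of 0 \<Rightarrow> None | Suc 0 \<Rightarrow> c i | Suc (Suc k) \<Rightarrow> S (i, Suc k))"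

definition remove_column :: "filling \<Rightarrow> filling" where
  "remove_column S = (\<lambda>(i, j). case j of 0 \<Rightarrow> None | Suc k \<Rightarrow> S (i, Suc (Suc k)))"

lemma column_index_cases:
  obtains "j = 0" | "j = Suc 0" | k where "j = Suc (Suc k)"
  by (cases j; cases "j - 1") auto

lemma attach_column_simps [simp]:
  "attach_column c S (i, 0) = None"
  "attach_column c S (i, Suc 0) = c i"
  "attach_column c S (i, Suc (Suc k)) = S (i, Suc k)"
  by (simp_all add: attach_column_def)

lemma remove_column_simps [simp]:
  "remove_column S (i, 0) = None"
  "remove_column S (i, Suc k) = S (i, Suc (Suc k))"
  by (simp_all add: remove_column_def)

text \<open>The two rules about empty boxes, stated for all pairs of indices: this is possible because a
  filling is empty outside the diagram, and it avoids checking that boxes stay in the diagram when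
  columns are shifted.\<close>

lemma staircase_tableauxI:
  assumes "\<And>i j. (i, j) \<notin> boxes n \<Longrightarrow> S (i, j) = None"
    and "\<And>i j. (i, j) \<in> diagonal n \<Longrightarrow> S (i, j) \<noteq> None"
    and "\<And>i j j'. S (i, j) = Some Beta \<Longrightarrow> j' < j \<Longrightarrow> S (i, j') = None"
    and "\<And>i i' j. S (i, j) = Some Alpha \<Longrightarrow> i' < i \<Longrightarrow> S (i', j) = None"
  shows "S \<in> staircase_tableaux n"
  unfolding staircase_tableaux_def mem_Collect_eq
proof (intro conjI allI ballI impI)
  show "S c = None" if "c \<notin> boxes n" for c
    using assms(1)[of "fst c" "snd c"] that by simp
  show "S c \<noteq> None" if "c \<in> diagonal n" for c
    using assms(2)[of "fst c" "snd c"] that by simp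
  show "S (i, j') = None" if "(i, j) \<in> boxes n \<and> S (i, j) = Some Beta \<and> j' < j" for i j j'
    using assms(3) that by blast
  show "S (i', j) = None" if "(i, j) \<in> boxes n \<and> S (i, j) = Some Alpha \<and> i' < i" for i i' j
    using assms(4) that by blast
qed

lemma staircase_tableauxD:
  assumes "S \<in> staircase_tableaux n"
  shows "(i, j) \<notin> boxes n \<Longrightarrow> S (i, j) = None"
    and "(i, j) \<in> diagonal n \<Longrightarrow> S (i, j) \<noteq> None"
    and "S (i, j) = Some Beta \<Longrightarrow> j' < j \<Longrightarrow> S (i, j') = None"
    and "S (i, j) = Some Alpha \<Longrightarrow> i' < i \<Longrightarrow> S (i', j) = None"
proof -
  have out: "\<And>c. c \<notin> boxes n \<Longrightarrow> S c = None"
    and diag: "\<And>c. c \<in> diagonal n \<Longrightarrow> S c \<noteq> None"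
    and beta: "\<And>i j j'. (i, j) \<in> boxes n \<Longrightarrow> S (i, j) = Some Beta \<Longrightarrow> j' < j \<Longrightarrow> S (i, j') = None"
    and alpha: "\<And>i i' j. (i, j) \<in> boxes n \<Longrightarrow> S (i, j) = Some Alpha \<Longrightarrow> i' < i \<Longrightarrow> S (i', j) = None"
    using assms unfolding staircase_tableaux_def by blast+
  show "(i, j) \<notin> boxes n \<Longrightarrow> S (i, j) = None" by (rule out)
  show "(i, j) \<in> diagonal n \<Longrightarrow> S (i, j) \<noteq> None" by (rule diag)
  show "S (i, j) = Some Beta \<Longrightarrow> j' < j \<Longrightarrow> S (i, j') = None"
    using beta out[of "(i, j)"] by (cases "(i, j) \<in> boxes n") auto
  show "S (i, j) = Some Alpha \<Longrightarrow> i' < i \<Longrightarrow> S (i', j) = None"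
    using alpha out[of "(i, j)"] by (cases "(i, j) \<in> boxes n") auto
qed

lemma staircase_tableaux_0: "staircase_tableaux 0 = {\<lambda>_. None}"
proof -
  have "boxes 0 = {}" "diagonal 0 = {}"
    by (auto simp: boxes_def diagonal_def)
  then show ?thesis by (auto simp: staircase_tableaux_def)
qed

lemma attach_column_in_tableaux:
  assumes S: "S \<in> staircase_tableaux n" and c: "c \<in> first_columns n S"
  shows "attach_column c S \<in> staircase_tableaux (Suc n)"
proof -
  note D = staircase_tableauxD[OF S]
  have out: "c i = None" if "i \<noteq> Suc n" "i \<notin> beta_free_rows n S" for i
    using c that by (auto simp: first_columns_def columns_def)
  have alpha: "c i' = None" if "c i = Some Alpha" "i' < i" for i i'
    using c that by (auto simp: first_columns_def columns_def)
  have bottom: "c (Suc n) \<noteq> None"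
    using c by (auto simp: first_columns_def)
  show ?thesis
  proof (rule staircase_tableauxI)
    fix i j assume nb: "(i, j) \<notin> boxes (Suc n)"
    consider "j = 0" | "j = Suc 0" | k where "j = Suc (Suc k)"
      by (rule column_index_cases)
    then show "attach_column c S (i, j) = None"
    proof cases
      case 2
      then show ?thesis using nb by (auto simp: boxes_def beta_free_rows_def intro!: out)
    next
      case (3 k)
      then show ?thesis using nb by (auto simp: boxes_def intro!: D(1))
    qed auto
  next
    fix i j assume d: "(i, j) \<in> diagonal (Suc n)"
    then consider "j = Suc 0" "i = Suc n" | k where "j = Suc (Suc k)" "(i, Suc k) \<in> diagonal n"
      by (cases j; cases "j - 1") (auto simp: diagonal_def)
    then show "attach_column c S (i, j) \<noteq> None"
      by cases (use bottom D(2) in auto)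
  next
    fix i j j' assume b: "attach_column c S (i, j) = Some Beta" and j': "j' < j"
    consider "j' = 0" | "j' = Suc 0" | k where "j' = Suc (Suc k)"
      by (rule column_index_cases)
    then show "attach_column c S (i, j') = None"
    proof cases
      case 2
      then obtain k where k: "j = Suc (Suc k)" using j' by (cases j rule: column_index_cases) auto
      then have "i \<notin> beta_free_rows n S" "S (i, Suc k) \<noteq> None"
        using b by (auto simp: beta_free_rows_def)
      moreover from this(2) have "i \<noteq> Suc n"
        using D(1)[of i "Suc k"] by (auto simp: boxes_def)
      ultimately show ?thesis using out 2 by simp
    next
      case (3 k')
      then obtain k where k: "j = Suc (Suc k)" using j' by (cases j rule: column_index_cases) auto
      show ?thesis using b j' unfolding k 3 by (auto intro: D(3))
    qed simp
  next
    fix i i' j assume a: "attach_column c S (i, j) = Some Alpha" and i': "i' < i"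
    consider "j = 0" | "j = Suc 0" | k where "j = Suc (Suc k)"
      by (rule column_index_cases)
    then show "attach_column c S (i', j) = None"
      by cases (use a i' in \<open>auto intro: alpha D(4)\<close>)
  qed
qed

lemma remove_column_in_tableaux:
  assumes S: "S \<in> staircase_tableaux (Suc n)"
  shows "remove_column S \<in> staircase_tableaux n"
proof (rule staircase_tableauxI)
  note D = staircase_tableauxD[OF S]
  fix i i' j j'
  show "remove_column S (i, j) = None" if "(i, j) \<notin> boxes n"
  proof (cases j)
    case (Suc k)
    then have "(i, Suc j) \<notin> boxes (Suc n)" using that by (auto simp: boxes_def)
    then show ?thesis using D(1) Suc by simp
  qed simp
  show "remove_column S (i, j) \<noteq> None" if d: "(i, j) \<in> diagonal n"
  proof (cases j)
    case 0
    then show ?thesis using d by (simp add: diagonal_def)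
  next
    case (Suc k)
    then have "(i, Suc j) \<in> diagonal (Suc n)" using d by (auto simp: diagonal_def)
    from D(2)[OF this] show ?thesis using Suc by simp
  qed
  show "remove_column S (i, j') = None" if b: "remove_column S (i, j) = Some Beta" "j' < j"
  proof (cases j')
    case (Suc k')
    then obtain k where k: "j = Suc k" using b by (cases j) auto
    show ?thesis using D(3)[of i "Suc j" "Suc j'"] b unfolding k Suc by simp
  qed simp
  show "remove_column S (i', j) = None" if a: "remove_column S (i, j) = Some Alpha" "i' < i"
  proof (cases j)
    case (Suc k)
    show ?thesis using D(4)[of i "Suc j" i'] a unfolding Suc by simp
  qed simp
qed

lemma first_column_in_first_columns:
  assumes S: "S \<in> staircase_tableaux (Suc n)"
  shows "(\<lambda>i. S (i, Suc 0)) \<in> first_columns n (remove_column S)"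
proof -
  note D = staircase_tableauxD[OF S]
  have "S (i, Suc 0) = None" if i: "i \<noteq> Suc n" "i \<notin> beta_free_rows n (remove_column S)" for i
  proof (cases "i \<in> {1..n}")
    case True
    then obtain j where j: "remove_column S (i, j) = Some Beta"
      using i unfolding beta_free_rows_def by blast
    then obtain k where k: "S (i, Suc (Suc k)) = Some Beta"
      by (cases j) simp_all
    show ?thesis by (rule D(3)[OF k]) simp
  next
    case False
    then have "(i, Suc 0) \<notin> boxes (Suc n)" using i(1) by (auto simp: boxes_def)
    then show ?thesis by (rule D(1))
  qed
  then have out: "\<forall>i. i \<notin> insert (Suc n) (beta_free_rows n (remove_column S)) \<longrightarrow> S (i, Suc 0) = None"
    by simp
  have bottom: "S (Suc n, Suc 0) \<noteq> None"
    by (rule D(2)) (simp add: diagonal_def)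
  have "\<forall>i i'. S (i, Suc 0) = Some Alpha \<and> i' < i \<longrightarrow> S (i', Suc 0) = None"
    using D(4) by blast
  with out bottom show ?thesis
    unfolding first_columns_def columns_def by simp
qed

lemma attach_remove_column:
  assumes S: "S \<in> staircase_tableaux (Suc n)"
  shows "attach_column (\<lambda>i. S (i, Suc 0)) (remove_column S) = S"
proof
  fix p :: "nat \<times> nat"
  obtain i j where p: "p = (i, j)" by (cases p)
  have "S (i, 0) = None"
    by (rule staircase_tableauxD(1)[OF S]) (simp add: boxes_def)
  then show "attach_column (\<lambda>i. S (i, Suc 0)) (remove_column S) p = S p"
    unfolding p by (cases j; cases "j - 1") auto
qed

lemma remove_attach_column:
  assumes S: "S \<in> staircase_tableaux n"
  shows "remove_column (attach_column c S) = S"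
proof
  fix p :: "nat \<times> nat"
  obtain i j where p: "p = (i, j)" by (cases p)
  have "S (i, 0) = None"
    by (rule staircase_tableauxD(1)[OF S]) (simp add: boxes_def)
  then show "remove_column (attach_column c S) p = S p"
    unfolding p by (cases j) auto
qed

lemma sum_staircase_tableaux_Suc:
  fixes f :: "filling \<Rightarrow> real"
  shows "(\<Sum>S\<in>staircase_tableaux (Suc n). f S) =
    (\<Sum>S\<in>staircase_tableaux n. \<Sum>c\<in>first_columns n S. f (attach_column c S))"
proof -
  have "finite (first_columns n S)" for S
    unfolding first_columns_def
    by (rule finite_subset[OF _ finite_columns[of "insert (Suc n) (beta_free_rows n S)"]])
      (auto simp: beta_free_rows_def)
  then have "(\<Sum>S\<in>staircase_tableaux n. \<Sum>c\<in>first_columns n S. f (attach_column c S)) =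
     (\<Sum>(S, c)\<in>(SIGMA S:staircase_tableaux n. first_columns n S). f (attach_column c S))"
    by (intro sum.Sigma) (auto simp: finite_staircase_tableaux)
  also have "\<dots> = (\<Sum>S\<in>staircase_tableaux (Suc n). f S)"
    by (rule sum.reindex_bij_witness[where i = "\<lambda>S. (remove_column S, \<lambda>i. S (i, Suc 0))"
          and j = "\<lambda>(S, c). attach_column c S"])
      (auto simp: attach_column_in_tableaux remove_column_in_tableaux first_column_in_first_columns
        attach_remove_column remove_attach_column)
  finally show ?thesis by simp
qed

section \<open>The generating function refined by the number of free rows\<close>

text \<open>The number of free rows is recorded by \<open>z\<close> because, of all features of a tableau, it alone
  determines the total weight of the columns that can be attached.\<close>

definition refined_weight :: "real \<Rightarrow> real \<Rightarrow> real \<Rightarrow> real \<Rightarrow> nat \<Rightarrow> filling \<Rightarrow> real" where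
  "refined_weight \<alpha> \<beta> x z n S =
     weight \<alpha> \<beta> S * x ^ diag_alphas n S * z ^ card (beta_free_rows n S)"

lemma num_symbol_attach_column:
  assumes S: "S \<in> staircase_tableaux n" and c: "c \<in> first_columns n S"
  shows "num_symbol s (attach_column c S) = num_symbol s S + card {i. c i = Some s}"
proof -
  note D = staircase_tableauxD[OF S]
  have "boxes n \<subseteq> {..n+1} \<times> {..n+1}" by (auto simp: boxes_def)
  then have "finite (boxes n)" by (rule finite_subset) auto
  moreover have "{p. S p = Some s} \<subseteq> boxes n" using D(1) by force
  ultimately have finS: "finite {p. S p = Some s}" using finite_subset by blast
  have "{i. c i = Some s} \<subseteq> insert (Suc n) (beta_free_rows n S)"
    using c by (auto simp: first_columns_def columns_def)
  then have finc: "finite {i. c i = Some s}"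
    by (rule finite_subset) (simp add: beta_free_rows_def)
  have eq: "{p. attach_column c S p = Some s} =
     (\<lambda>(i, j). (i, Suc j)) ` {p. S p = Some s} \<union> (\<lambda>i. (i, Suc 0)) ` {i. c i = Some s}"
  proof (intro equalityI subsetI)
    fix p assume p: "p \<in> {p. attach_column c S p = Some s}"
    obtain i j where ij: "p = (i, j)" by (cases p)
    consider "j = 0" | "j = Suc 0" | k where "j = Suc (Suc k)"
      by (rule column_index_cases)
    then show "p \<in> (\<lambda>(i, j). (i, Suc j)) ` {p. S p = Some s} \<union> (\<lambda>i. (i, Suc 0)) ` {i. c i = Some s}"
      using p by cases (auto simp: ij image_iff)
  next
    fix p assume "p \<in> (\<lambda>(i, j). (i, Suc j)) ` {p. S p = Some s} \<union> (\<lambda>i. (i, Suc 0)) ` {i. c i = Some s}"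
    then show "p \<in> {p. attach_column c S p = Some s}"
    proof
      assume "p \<in> (\<lambda>(i, j). (i, Suc j)) ` {p. S p = Some s}"
      then obtain i j where ij: "p = (i, Suc j)" "S (i, j) = Some s" by auto
      then have "j \<noteq> 0" using D(1)[of i 0] by (intro notI) (simp add: boxes_def)
      with ij show ?thesis by (cases j) auto
    qed auto
  qed
  have "S (i, 0) = None" for i
    by (rule D(1)) (simp add: boxes_def)
  then have disj: "(\<lambda>(i, j). (i, Suc j)) ` {p. S p = Some s} \<inter> (\<lambda>i. (i, Suc 0)) ` {i. c i = Some s} = {}"
    by auto
  show ?thesis
    unfolding num_symbol_def eq
    by (subst card_Un_disjoint)
      (use finS finc disj in \<open>auto simp: card_image inj_on_def\<close>)
qed

lemma finite_diagonal: "finite (diagonal n)" and card_diagonal: "card (diagonal n) = n"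
proof -
  have eq: "diagonal n = (\<lambda>i. (i, Suc n - i)) ` {1..n}"
    by (auto simp: diagonal_def image_iff)
  show "finite (diagonal n)" unfolding eq by simp
  show "card (diagonal n) = n" unfolding eq by (subst card_image) (auto simp: inj_on_def)
qed

lemma diag_alphas_attach_column:
  "diag_alphas (Suc n) (attach_column c S) = diag_alphas n S + of_bool (c (Suc n) = Some Alpha)"
proof -
  let ?D = "{p \<in> diagonal n. S p = Some Alpha}"
  have eq: "{p \<in> diagonal (Suc n). attach_column c S p = Some Alpha} =
     (\<lambda>(i, j). (i, Suc j)) ` ?D \<union> (if c (Suc n) = Some Alpha then {(Suc n, Suc 0)} else {})"
  proof (intro equalityI subsetI)
    fix p assume p: "p \<in> {p \<in> diagonal (Suc n). attach_column c S p = Some Alpha}"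
    obtain i j where ij: "p = (i, j)" by (cases p)
    consider "j = 0" | "j = Suc 0" | k where "j = Suc (Suc k)"
      by (rule column_index_cases)
    then show "p \<in> (\<lambda>(i, j). (i, Suc j)) ` ?D \<union> (if c (Suc n) = Some Alpha then {(Suc n, Suc 0)} else {})"
      using p by cases (auto simp: ij image_iff diagonal_def)
  next
    fix p assume "p \<in> (\<lambda>(i, j). (i, Suc j)) ` ?D \<union> (if c (Suc n) = Some Alpha then {(Suc n, Suc 0)} else {})"
    then show "p \<in> {p \<in> diagonal (Suc n). attach_column c S p = Some Alpha}"
    proof
      assume "p \<in> (\<lambda>(i, j). (i, Suc j)) ` ?D"
      then obtain i j where ij: "p = (i, Suc j)" "S (i, j) = Some Alpha" "(i, j) \<in> diagonal n" by auto
      then show ?thesis by (cases j) (auto simp: diagonal_def)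
    qed (auto simp: diagonal_def split: if_splits)
  qed
  have "(Suc n, Suc 0) \<notin> (\<lambda>(i, j). (i, Suc j)) ` ?D"
    by (auto simp: diagonal_def)
  moreover have "finite ?D" using finite_diagonal by simp
  moreover have "card ((\<lambda>(i, j). (i, Suc j)) ` ?D) = card ?D"
    by (rule card_image) (auto simp: inj_on_def)
  ultimately show ?thesis
    unfolding diag_alphas_def eq by simp
qed

lemma beta_free_rows_attach_column:
  assumes S: "S \<in> staircase_tableaux n"
  shows "beta_free_rows (Suc n) (attach_column c S) =
    {i \<in> insert (Suc n) (beta_free_rows n S). c i \<noteq> Some Beta}"
proof -
  note D = staircase_tableauxD[OF S]
  have last: "S (Suc n, j) = None" for j
    by (rule D(1)) (simp add: boxes_def)
  have zero: "S (i, 0) = None" for i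
    by (rule D(1)) (simp add: boxes_def)
  have "(\<forall>j. attach_column c S (i, j) \<noteq> Some Beta) \<longleftrightarrow>
      c i \<noteq> Some Beta \<and> (\<forall>j. S (i, j) \<noteq> Some Beta)" for i
  proof safe
    assume h: "\<forall>j. attach_column c S (i, j) \<noteq> Some Beta"
    then show "c i = Some Beta \<Longrightarrow> False" by (metis attach_column_simps(2))
    fix j assume "S (i, j) = Some Beta"
    then show False using h[rule_format, of "Suc j"] zero by (cases j) auto
  next
    fix j assume h: "\<forall>j. S (i, j) \<noteq> Some Beta" "c i \<noteq> Some Beta" "attach_column c S (i, j) = Some Beta"
    then show False by (cases j; cases "j - 1") auto
  qed
  then show ?thesis
    unfolding beta_free_rows_def by (auto simp: last le_Suc_eq)
qed

lemma refined_weight_attach_column: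
  assumes S: "S \<in> staircase_tableaux n" and c: "c \<in> first_columns n S"
  shows "refined_weight \<alpha> \<beta> x z (Suc n) (attach_column c S) =
    weight \<alpha> \<beta> S * x ^ diag_alphas n S * (if c (Suc n) = Some Alpha then x else 1)
      * (\<Prod>i\<in>insert (Suc n) (beta_free_rows n S). cell_weight \<alpha> \<beta> z (c i))"
proof -
  have "c \<in> columns (insert (Suc n) (beta_free_rows n S))"
    using c by (simp add: first_columns_def)
  moreover have "finite (insert (Suc n) (beta_free_rows n S))"
    by (simp add: beta_free_rows_def)
  ultimately show ?thesis
    by (simp only: prod_cell_weight refined_weight_def weight_def beta_free_rows_attach_column[OF S]
        num_symbol_attach_column[OF S c] diag_alphas_attach_column) (simp add: power_add mult_ac)
qed

text \<open>For a fixed tableau with \<open>r\<close> free rows, the new columns with an \<open>\<alpha>\<close> in the diagonal box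
  contribute \<open>x \<alpha> z z\<^sup>r\<close>, and those with a \<open>\<beta>\<close> there contribute
  \<open>(\<beta> + \<alpha> z) (z + \<beta>)\<^sup>r - \<alpha> z z\<^sup>r\<close> by \<open>sum_columns\<close>. The powers \<open>z\<^sup>r\<close> and \<open>(z + \<beta>)\<^sup>r\<close> give back the
  refined weight of the smaller tableau at \<open>z\<close> and at \<open>z + \<beta>\<close>.\<close>

lemma sum_refined_weight_Suc:
  "(\<Sum>S\<in>staircase_tableaux (Suc n). refined_weight \<alpha> \<beta> x z (Suc n) S) =
    \<alpha> * z * (x - 1) * (\<Sum>S\<in>staircase_tableaux n. refined_weight \<alpha> \<beta> x z n S)
    + (\<beta> + \<alpha> * z) * (\<Sum>S\<in>staircase_tableaux n. refined_weight \<alpha> \<beta> x (z + \<beta>) n S)"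
proof -
  have "(\<Sum>c\<in>first_columns n S. refined_weight \<alpha> \<beta> x z (Suc n) (attach_column c S)) =
      \<alpha> * z * (x - 1) * refined_weight \<alpha> \<beta> x z n S
      + (\<beta> + \<alpha> * z) * refined_weight \<alpha> \<beta> x (z + \<beta>) n S"
    if S: "S \<in> staircase_tableaux n" for S
  proof -
    define R where "R = beta_free_rows n S"
    have fin: "finite R" and lt: "\<And>i. i \<in> R \<Longrightarrow> i < Suc n"
      by (auto simp: R_def beta_free_rows_def)
    then have notin: "Suc n \<notin> R" by blast
    define w where "w = weight \<alpha> \<beta> S * x ^ diag_alphas n S"
    have upd: "(\<Prod>i\<in>R. cell_weight \<alpha> \<beta> z ((c(Suc n := s)) i)) = (\<Prod>i\<in>R. cell_weight \<alpha> \<beta> z (c i))" for c s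
      using notin by (intro prod.cong) auto
    have split: "(\<Sum>c\<in>first_columns n S. f c) =
        f ((\<lambda>_. None)(Suc n := Some Alpha)) + (\<Sum>c\<in>columns R. f (c(Suc n := Some Beta)))"
      for f :: "_ \<Rightarrow> real"
      unfolding first_columns_def R_def[symmetric]
      using lt by (rule sum_columns_bottom_filled[OF fin])
    have "(\<Sum>c\<in>first_columns n S. refined_weight \<alpha> \<beta> x z (Suc n) (attach_column c S)) =
        (\<Sum>c\<in>first_columns n S. w * (if c (Suc n) = Some Alpha then x else 1)
          * (\<Prod>i\<in>insert (Suc n) R. cell_weight \<alpha> \<beta> z (c i)))"
      by (rule sum.cong) (simp_all only: refined_weight_attach_column[OF S] w_def R_def)
    also have "\<dots> = w * x * \<alpha> * z * z ^ card R
        + w * (\<beta> * (\<Sum>c\<in>columns R. \<Prod>i\<in>R. cell_weight \<alpha> \<beta> z (c i)))"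
      unfolding split prod.insert[OF fin notin] upd
      by (simp add: sum_distrib_left mult_ac)
    also have "\<dots> = \<alpha> * z * (x - 1) * (w * z ^ card R) + (\<beta> + \<alpha> * z) * (w * (z + \<beta>) ^ card R)"
      unfolding sum_columns[OF fin] by (simp add: algebra_simps)
    finally show ?thesis
      by (simp add: refined_weight_def w_def R_def)
  qed
  then show ?thesis
    by (simp add: sum_staircase_tableaux_Suc sum.distrib sum_distrib_left)
qed

text \<open>The substitution \<open>z = \<beta> y\<close> turns the step from \<open>z\<close> to \<open>z + \<beta>\<close> into the step from \<open>y\<close> to
  \<open>y + 1\<close>, which is the shift of the second parameter in \<open>P_Suc\<close>.\<close>

lemma sum_refined_weight:
  assumes \<alpha>: "\<alpha> \<noteq> 0" and \<beta>: "\<beta> \<noteq> 0"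
  shows "(\<Sum>S\<in>staircase_tableaux n. refined_weight \<alpha> \<beta> x z n S) =
    (\<alpha> * \<beta>) ^ n * P n (1 / \<alpha>) (z / \<beta>) x"
proof (induction n arbitrary: z)
  case 0
  then show ?case
    by (simp add: staircase_tableaux_0 refined_weight_def weight_def num_symbol_def diag_alphas_def
        beta_free_rows_def P_def diagonal_def)
next
  case (Suc n)
  define y where "y = z / \<beta>"
  have "(z + \<beta>) / \<beta> = y + 1" "\<alpha> * z = \<alpha> * \<beta> * y" "\<beta> + \<alpha> * z = \<alpha> * \<beta> * (1 / \<alpha> + y)"
    using \<alpha> \<beta> by (simp_all add: y_def field_simps)
  then have "(\<Sum>S\<in>staircase_tableaux (Suc n). refined_weight \<alpha> \<beta> x z (Suc n) S) =
      \<alpha> * \<beta> * y * (x - 1) * ((\<alpha> * \<beta>) ^ n * P n (1 / \<alpha>) y x)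
      + \<alpha> * \<beta> * (1 / \<alpha> + y) * ((\<alpha> * \<beta>) ^ n * P n (1 / \<alpha>) (y + 1) x)"
    by (simp only: sum_refined_weight_Suc Suc.IH y_def)
  also have "\<dots> = (\<alpha> * \<beta>) ^ Suc n * P (Suc n) (1 / \<alpha>) y x"
    by (simp only: P_Suc power_Suc algebra_simps)
  finally show ?case by (simp only: y_def)
qed

section \<open>Probability generating functions for finite and infinite parameters\<close>

lemma sum_tableau_prob_finite_diag_alphas:
  assumes "\<alpha> > 0" "\<beta> > 0"
  shows "(\<Sum>S\<in>staircase_tableaux n. tableau_prob_finite n \<alpha> \<beta> S * x ^ diag_alphas n S) =
    P n (1 / \<alpha>) (1 / \<beta>) x / P n (1 / \<alpha>) (1 / \<beta>) 1"
proof -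
  have gf: "(\<Sum>S\<in>staircase_tableaux n. weight \<alpha> \<beta> S * y ^ diag_alphas n S) =
      (\<alpha> * \<beta>) ^ n * P n (1 / \<alpha>) (1 / \<beta>) y" for y
    using sum_refined_weight[of \<alpha> \<beta> y 1 n] assms by (simp add: refined_weight_def)
  have "Z n \<alpha> \<beta> = (\<alpha> * \<beta>) ^ n * P n (1 / \<alpha>) (1 / \<beta>) 1"
    using gf[of 1] by (simp add: Z_def)
  then have "(\<Sum>S\<in>staircase_tableaux n. tableau_prob_finite n \<alpha> \<beta> S * x ^ diag_alphas n S) =
     (\<Sum>S\<in>staircase_tableaux n. weight \<alpha> \<beta> S * x ^ diag_alphas n S)
       / ((\<alpha> * \<beta>) ^ n * P n (1 / \<alpha>) (1 / \<beta>) 1)"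
    by (simp add: tableau_prob_finite_def sum_divide_distrib)
  then show ?thesis
    using assms by (simp add: gf)
qed

lemma tendsto_P:
  assumes f: "(f \<longlongrightarrow> a) F" and g: "(g \<longlongrightarrow> b) F"
  shows "((\<lambda>t. P n (f t) (g t) x) \<longlongrightarrow> P n a b x) F"
proof -
  have "((\<lambda>t. v (f t) (g t) n k) \<longlongrightarrow> v a b n k) F" for k
  proof (induction n arbitrary: k)
    case (Suc n)
    then show ?case by (simp del: of_nat_Suc) (intro tendsto_intros f g Suc.IH)
  qed simp
  then show ?thesis
    unfolding P_def by (intro tendsto_intros)
qed

lemma tendsto_inverse_param: "((\<lambda>t::real. 1 / t) \<longlongrightarrow> 0) at_top"
  using tendsto_inverse_0_at_top[OF filterlim_ident] by (simp add: inverse_eq_divide)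

text \<open>The three limits that define the distribution for infinite parameters differ only in how the
  two finite parameters depend on \<open>t\<close>. The set of tableaux is finite, so the limit of the
  probabilities can be taken under the sum.\<close>

lemma sum_tableau_prob_limit:
  assumes lim: "\<And>S. ((\<lambda>t. tableau_prob_finite n (f t) (g t) S) \<longlongrightarrow> p S) (at_top :: real filter)"
    and pos: "\<And>t. t > 0 \<Longrightarrow> f t > 0 \<and> g t > 0"
    and L: "((\<lambda>t. P n (1 / f t) (1 / g t) x / P n (1 / f t) (1 / g t) 1) \<longlongrightarrow> L) at_top"
  shows "(\<Sum>S\<in>staircase_tableaux n. p S * x ^ diag_alphas n S) = L"
proof (rule tendsto_unique[OF trivial_limit_at_top_linorder _ L])
  have "((\<lambda>t. \<Sum>S\<in>staircase_tableaux n. tableau_prob_finite n (f t) (g t) S * x ^ diag_alphas n S)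
      \<longlongrightarrow> (\<Sum>S\<in>staircase_tableaux n. p S * x ^ diag_alphas n S)) at_top"
    by (intro tendsto_intros lim)
  moreover have "\<forall>\<^sub>F t in at_top.
      (\<Sum>S\<in>staircase_tableaux n. tableau_prob_finite n (f t) (g t) S * x ^ diag_alphas n S)
      = P n (1 / f t) (1 / g t) x / P n (1 / f t) (1 / g t) 1"
    using eventually_gt_at_top[of 0]
    by eventually_elim (simp add: sum_tableau_prob_finite_diag_alphas pos)
  ultimately show "((\<lambda>t. P n (1 / f t) (1 / g t) x / P n (1 / f t) (1 / g t) 1)
      \<longlongrightarrow> (\<Sum>S\<in>staircase_tableaux n. p S * x ^ diag_alphas n S)) at_top"
    by (rule Lim_transform_eventually)
qed

lemma sum_tableau_prob_diag_alphas:
  assumes "\<alpha> > 0" "\<beta> > 0" "(\<alpha>, \<beta>) \<noteq> (\<infinity>, \<infinity>)"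
  defines "a \<equiv> real_of_ereal (inverse \<alpha>)" and "b \<equiv> real_of_ereal (inverse \<beta>)"
  shows "(\<Sum>S\<in>staircase_tableaux n. tableau_prob n \<alpha> \<beta> S * x ^ diag_alphas n S) =
    P n a b x / P n a b 1"
proof -
  have P1: "P n c d 1 \<noteq> 0" if "c + d > 0" for c d
    using pochhammer_pos[OF that, of n] by (simp add: P_at_1)
  consider r s where "\<alpha> = ereal r" "\<beta> = ereal s" "r > 0" "s > 0"
    | s where "\<alpha> = \<infinity>" "\<beta> = ereal s" "s > 0" | r where "\<alpha> = ereal r" "\<beta> = \<infinity>" "r > 0"
    using assms(1-3) by (cases \<alpha>; cases \<beta>) auto
  then show ?thesis
  proof cases
    case (1 r s)
    then show ?thesis
      using sum_tableau_prob_finite_diag_alphas[of r s n x]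
      by (simp add: tableau_prob_def a_def b_def inverse_eq_divide)
  next
    case (2 s)
    have "(\<Sum>S\<in>staircase_tableaux n. tableau_prob n \<infinity> (ereal s) S * x ^ diag_alphas n S) =
        P n 0 (1 / s) x / P n 0 (1 / s) 1"
      by (rule sum_tableau_prob_limit[OF tableau_prob_limits(2)])
        (use 2 in \<open>auto intro!: tendsto_divide tendsto_P tendsto_inverse_param tendsto_const P1\<close>)
    then show ?thesis using 2 by (simp add: a_def b_def inverse_eq_divide)
  next
    case (3 r)
    have "(\<Sum>S\<in>staircase_tableaux n. tableau_prob n (ereal r) \<infinity> S * x ^ diag_alphas n S) =
        P n (1 / r) 0 x / P n (1 / r) 0 1"
      by (rule sum_tableau_prob_limit[OF tableau_prob_limits(3)])
        (use 3 in \<open>auto intro!: tendsto_divide tendsto_P tendsto_inverse_param tendsto_const P1\<close>)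
    then show ?thesis using 3 by (simp add: a_def b_def inverse_eq_divide)
  qed
qed

text \<open>The numbers \<open>v_tilde\<close>, defined through the parameters \<open>(1, 1)\<close>, are also the numbers for the
  parameters \<open>(0, 1)\<close>. The latter are the ones that appear in the limit below.\<close>

lemma v_0_1_eq: "v 0 1 (Suc m) k = v 1 1 m (k - 1)"
proof (induction m arbitrary: k)
  case 0
  then show ?case by auto
next
  case (Suc m)
  have "v 0 1 (Suc (Suc m)) k =
      of_int k * v 0 1 (Suc m) k + (real (Suc (Suc m)) - of_int k + 1) * v 0 1 (Suc m) (k - 1)"
    by simp
  also have "\<dots> = v 1 1 (Suc m) (k - 1)"
    by (simp only: Suc.IH) (simp add: algebra_simps)
  finally show ?case .
qed

lemma v_tilde_eq_v: "n \<ge> 2 \<Longrightarrow> v_tilde n k = v 0 1 (n - 1) k"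
  using v_0_1_eq[of "n - 2" k] by (simp add: v_tilde_def Suc_diff_Suc numeral_2_eq_2)

lemma P_tilde_eq_P:
  assumes "n \<ge> 2"
  shows "P_tilde n x = P (n - 1) 0 1 x"
proof -
  obtain m where m: "n = Suc m" "m \<ge> 1" using assms by (cases n) auto
  show ?thesis
    using assms by (simp add: P_tilde_def P_def v_tilde_eq_v m(1)) (simp add: v_eq_0)
qed

lemma P_tilde_at_1: "n \<ge> 2 \<Longrightarrow> P_tilde n 1 = fact (n - 1)"
  by (simp add: P_tilde_eq_P P_at_1 pochhammer_fact)

text \<open>For \<open>a = b\<close> both terms of the recursion \<open>P_Suc\<close> have the factor \<open>a\<close>. After it is cancelled from
  numerator and denominator, the limit \<open>a \<rightarrow> 0\<close> of each is finite, and that of the denominator is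
  not 0.\<close>

lemma sum_tableau_prob_diag_alphas_infinite:
  assumes n: "n \<ge> 2"
  shows "(\<Sum>S\<in>staircase_tableaux n. tableau_prob n \<infinity> \<infinity> S * x ^ diag_alphas n S) =
    P_tilde n x / P_tilde n 1"
proof (rule sum_tableau_prob_limit[OF tableau_prob_limits(1)])
  obtain m where m: "n = Suc (Suc m)"
    using n that[of "n - 2"] by linarith
  let ?q = "\<lambda>a y. (y - 1) / 2 * P (Suc m) a a y + P (Suc m) a (a + 1) y"
  have q: "P n a a y = 2 * a * ?q a y" for a y
    unfolding m P_Suc[of "Suc m"] by (simp add: field_simps)
  \<comment> \<open>The first term of \<open>?q\<close> disappears, since \<open>P (Suc m) 0 0\<close> has the factors \<open>b = 0\<close> and \<open>a + b = 0\<close>.\<close>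
  have q0: "?q 0 y = P_tilde n y" for y
    using n by (simp add: P_tilde_eq_P m P_Suc[of m 0 0])
  have lim: "((\<lambda>t::real. ?q (1 / t) y) \<longlongrightarrow> P_tilde n y) at_top" for y
    unfolding q0[symmetric]
    by (intro tendsto_intros tendsto_P tendsto_inverse_param tendsto_eq_intros(1)) auto
  have "((\<lambda>t::real. ?q (1 / t) x / ?q (1 / t) 1) \<longlongrightarrow> P_tilde n x / P_tilde n 1) at_top"
    by (intro tendsto_divide lim) (simp add: P_tilde_at_1 n)
  then show "((\<lambda>t::real. P n (1 / t) (1 / t) x / P n (1 / t) (1 / t) 1)
      \<longlongrightarrow> P_tilde n x / P_tilde n 1) at_top"
  proof (rule Lim_transform_eventually)
    show "\<forall>\<^sub>F t::real in at_top. ?q (1 / t) x / ?q (1 / t) 1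
        = P n (1 / t) (1 / t) x / P n (1 / t) (1 / t) 1"
      using eventually_gt_at_top[of 0]
    proof eventually_elim
      case (elim t)
      then have "2 * (1 / t) \<noteq> 0" by simp
      then show ?case unfolding q by (rule mult_divide_mult_cancel_left[symmetric])
    qed
  qed
qed auto

section \<open>The distribution of the number of diagonal \<open>\<alpha>\<close>\<close>

lemma diag_alphas_le: "diag_alphas n S \<le> n"
  using card_mono[OF finite_diagonal, of "{c \<in> diagonal n. S c = Some Alpha}" n]
  by (auto simp: diag_alphas_def card_diagonal)

text \<open>The number of diagonal \<open>\<alpha>\<close> lies between 0 and \<open>n\<close>, so its generating function is a polynomial
  of degree at most \<open>n\<close>, whose coefficients are determined by its values.\<close>

lemma distribution_of_diag_alphas:
  fixes d :: "int \<Rightarrow> real"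
  assumes pos: "\<alpha> > 0" "\<beta> > 0"
    and gf: "\<And>x. (\<Sum>S\<in>staircase_tableaux n. tableau_prob n \<alpha> \<beta> S * x ^ diag_alphas n S) =
      (\<Sum>k = 0..n. d (int k) * x ^ k)"
    and d0: "\<And>k. k < 0 \<or> k > int n \<Longrightarrow> d k = 0"
  defines "M \<equiv> tableau_pmf n \<alpha> \<beta>"
  shows "measure_pmf.prob M {S. int (diag_alphas n S) = k} = d k"
    and "measure_pmf.expectation M (\<lambda>S. x ^ diag_alphas n S) = (\<Sum>k = 0..n. d (int k) * x ^ k)"
proof -
  let ?T = "staircase_tableaux n" and ?p = "tableau_prob n \<alpha> \<beta>"
  have pmf: "pmf M S = ?p S" for S
    unfolding M_def by (rule pmf_tableau_pmf[OF pos])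
  have supp: "S \<in> ?T" if "S \<in> set_pmf M" for S
    using that tableau_prob_is_distribution[OF pos, of n] by (auto simp: set_pmf_iff pmf)
  have E: "measure_pmf.expectation M f = (\<Sum>S\<in>?T. ?p S * f S)" for f :: "filling \<Rightarrow> real"
    by (subst integral_measure_pmf_real[OF finite_staircase_tableaux[of n]])
      (auto simp: supp pmf mult.commute)
  show gM: "measure_pmf.expectation M (\<lambda>S. x ^ diag_alphas n S) = (\<Sum>k = 0..n. d (int k) * x ^ k)" for x
    by (simp add: E gf)
  let ?A = "\<lambda>k. {S. int (diag_alphas n S) = k}"
  have prob: "measure_pmf.prob M (?A k) = (\<Sum>S\<in>?T. ?p S * of_bool (int (diag_alphas n S) = k))" for k
  proof -
    have "measure_pmf.prob M (?A k) = measure_pmf.expectation M (indicator (?A k))"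
      by simp
    also have "\<dots> = (\<Sum>S\<in>?T. ?p S * of_bool (int (diag_alphas n S) = k))"
      unfolding E by (intro sum.cong) (auto simp: indicator_def)
    finally show ?thesis .
  qed
  have "(\<Sum>k\<le>n. measure_pmf.prob M (?A (int k)) * y ^ k) = (\<Sum>k\<le>n. d (int k) * y ^ k)" for y
  proof -
    have "(\<Sum>k\<le>n. measure_pmf.prob M (?A (int k)) * y ^ k) =
        (\<Sum>S\<in>?T. \<Sum>k\<le>n. ?p S * of_bool (diag_alphas n S = k) * y ^ k)"
      unfolding prob sum_distrib_right unfolding of_nat_eq_iff by (rule sum.swap)
    also have "\<dots> = (\<Sum>S\<in>?T. ?p S * y ^ diag_alphas n S)"
    proof (rule sum.cong[OF refl])
      fix S
      have "(\<Sum>k\<le>n. ?p S * of_bool (diag_alphas n S = k) * y ^ k) =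
          (\<Sum>k\<le>n. if k = diag_alphas n S then ?p S * y ^ k else 0)"
        by (intro sum.cong) auto
      then show "(\<Sum>k\<le>n. ?p S * of_bool (diag_alphas n S = k) * y ^ k) = ?p S * y ^ diag_alphas n S"
        by (simp add: diag_alphas_le)
    qed
    finally show ?thesis by (simp add: gf atLeast0AtMost)
  qed
  then have coeffs: "\<forall>k\<le>n. measure_pmf.prob M (?A (int k)) = d (int k)"
    by (subst polyfun_eq_coeffs[symmetric]) blast
  show "measure_pmf.prob M (?A k) = d k"
  proof (cases "k < 0 \<or> k > int n")
    case True
    have "int (diag_alphas n S) \<noteq> k" for S
      using True diag_alphas_le[of n S] by linarith
    then show ?thesis using True by (simp add: d0)
  next
    case False
    then have "int (nat k) = k" "nat k \<le> n" by auto
    with coeffs show ?thesis by metis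
  qed
qed

theorem theorem1p7:
  fixes \<alpha> \<beta> :: ereal and a b :: real and n :: nat
    and prob_A :: "int \<Rightarrow> real" and g_A :: "real \<Rightarrow> real"
  assumes "\<alpha> > 0" and "\<beta> > 0" and "n \<ge> 1"
    and "a = real_of_ereal (inverse \<alpha>)" and "b = real_of_ereal (inverse \<beta>)"
    and "\<And>k. prob_A k = measure_pmf.prob (tableau_pmf n \<alpha> \<beta>) {S. int (diag_alphas n S) = k}"
    and "\<And>x. g_A x = measure_pmf.expectation (tableau_pmf n \<alpha> \<beta>) (\<lambda>S. x ^ diag_alphas n S)"
  shows "((\<alpha>, \<beta>) \<noteq> (\<infinity>, \<infinity>) \<longrightarrow>
      (\<forall>x. g_A x = (\<Sum>k = 0..n. prob_A (int k) * x ^ k) \<and>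
           g_A x = P n a b x / P n a b 1 \<and>
           g_A x = P n a b x / pochhammer (a + b) n \<and>
           g_A x = Gamma (a + b) / Gamma (real n + a + b) * P n a b x) \<and>
      (\<forall>k. prob_A k = v a b n k / P n a b 1 \<and>
           prob_A k = v a b n k / pochhammer (a + b) n \<and>
           prob_A k = Gamma (a + b) / Gamma (real n + a + b) * v a b n k)) \<and>
     (\<alpha> = \<infinity> \<and> \<beta> = \<infinity> \<and> n \<ge> 2 \<longrightarrow>
      (\<forall>x. g_A x = (\<Sum>k = 0..n. prob_A (int k) * x ^ k) \<and>
           g_A x = P_tilde n x / P_tilde n 1 \<and>
           g_A x = P_tilde n x / fact (n - 1)) \<and>
      (\<forall>k. prob_A k = v_tilde n k / P_tilde n 1 \<and>
           prob_A k = v_tilde n k / fact (n - 1)))"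
proof -
  have sums: "(\<Sum>k = 0..n. f (int k) * x ^ k) / c = (\<Sum>k = 0..n. f (int k) / c * x ^ k)"
    for f :: "int \<Rightarrow> real" and x c
    by (simp add: sum_divide_distrib)
  show ?thesis
  proof (intro conjI impI)
    assume fin: "(\<alpha>, \<beta>) \<noteq> (\<infinity>, \<infinity>)"
    have ab: "a + b > 0"
      using assms(1,2) fin by (cases \<alpha>; cases \<beta>) (auto simp: assms(4,5) add_pos_pos)
    have p1: "P n a b 1 = pochhammer (a + b) n" by (rule P_at_1)
    have G: "Gamma (a + b) / Gamma (real n + a + b) * y = y / pochhammer (a + b) n" for y
    proof -
      have "a + b \<notin> \<int>\<^sub>\<le>\<^sub>0" using ab by (auto elim!: nonpos_Ints_cases)
      then have "pochhammer (a + b) n = Gamma (a + b + real n) / Gamma (a + b)"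
        by (rule pochhammer_Gamma)
      then show ?thesis by (simp add: add_ac)
    qed
    have out: "v a b n k / P n a b 1 = 0" if "k < 0 \<or> k > int n" for k
      using v_eq_0[OF that] assms(3) by simp
    have gf: "(\<Sum>S\<in>staircase_tableaux n. tableau_prob n \<alpha> \<beta> S * x ^ diag_alphas n S) =
        (\<Sum>k = 0..n. v a b n (int k) / P n a b 1 * x ^ k)" for x
      using sum_tableau_prob_diag_alphas[OF assms(1,2) fin, of n x]
      unfolding assms(4,5)[symmetric] by (simp only: P_def[of n a b x] sums)
    note law = distribution_of_diag_alphas[OF assms(1,2) gf out]
    have pA: "prob_A k = v a b n k / P n a b 1" for k
      unfolding assms(6) by (rule law(1))
    have gA: "g_A x = (\<Sum>k = 0..n. v a b n (int k) / P n a b 1 * x ^ k)" for x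
      unfolding assms(7) by (rule law(2))
    have gA': "g_A x = P n a b x / P n a b 1" for x
      by (simp only: gA P_def[of n a b x] sums)
    show "\<forall>x. g_A x = (\<Sum>k = 0..n. prob_A (int k) * x ^ k) \<and>
        g_A x = P n a b x / P n a b 1 \<and>
        g_A x = P n a b x / pochhammer (a + b) n \<and>
        g_A x = Gamma (a + b) / Gamma (real n + a + b) * P n a b x"
      unfolding G pA gA[symmetric] using gA' p1 by simp
    show "\<forall>k. prob_A k = v a b n k / P n a b 1 \<and>
        prob_A k = v a b n k / pochhammer (a + b) n \<and>
        prob_A k = Gamma (a + b) / Gamma (real n + a + b) * v a b n k"
      unfolding G pA p1 by simp
  next
    assume inf: "\<alpha> = \<infinity> \<and> \<beta> = \<infinity> \<and> n \<ge> 2"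
    then have n: "n \<ge> 2" by simp
    have out: "v_tilde n k / P_tilde n 1 = 0" if "k < 0 \<or> k > int n" for k
      unfolding v_tilde_eq_v[OF n] using that n by (subst v_eq_0) auto
    have gf: "(\<Sum>S\<in>staircase_tableaux n. tableau_prob n \<alpha> \<beta> S * x ^ diag_alphas n S) =
        (\<Sum>k = 0..n. v_tilde n (int k) / P_tilde n 1 * x ^ k)" for x
      using sum_tableau_prob_diag_alphas_infinite[OF n, of x] inf
      by (simp only: P_tilde_def[of n x] sums)
    note law = distribution_of_diag_alphas[OF assms(1,2) gf out]
    have pA: "prob_A k = v_tilde n k / P_tilde n 1" for k
      unfolding assms(6) by (rule law(1))
    have gA: "g_A x = (\<Sum>k = 0..n. v_tilde n (int k) / P_tilde n 1 * x ^ k)" for x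
      unfolding assms(7) by (rule law(2))
    have gA': "g_A x = P_tilde n x / P_tilde n 1" for x
      by (simp only: gA P_tilde_def[of n x] sums)
    show "\<forall>x. g_A x = (\<Sum>k = 0..n. prob_A (int k) * x ^ k) \<and>
        g_A x = P_tilde n x / P_tilde n 1 \<and>
        g_A x = P_tilde n x / fact (n - 1)"
      unfolding pA gA[symmetric] using gA' P_tilde_at_1[OF n] by simp
    show "\<forall>k. prob_A k = v_tilde n k / P_tilde n 1 \<and>
        prob_A k = v_tilde n k / fact (n - 1)"
      unfolding pA P_tilde_at_1[OF n] by simp
  qed
qed

end
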